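(* If a Hopf $A$-algebroid with a balancing subalgebra $\mathcal{B}$ satisfies $\mathrm{Im}\,\Delta\subset H\times_A H$ (where $H$ is its total algebra, $\Delta$ its coproduct and $H\times_A H$ the Takeuchi product), then it admits a (possibly nonunique) structure of Lu-Hopf algebroid.
   Context: Let $\bm k$ be a field, $\otimes=\otimes_{\bm k}$, all algebras associative $\bm k$-algebras, $A$ an associative unital algebra. **Data.** An $A\otimes A^{\mathrm{op}}$-ring $(H,\mu,\alpha,\beta)$ is an associative unital algebra $H$ with multiplication $\mu$ and unital algebra homomorphisms $\alpha\colon A\to H$, $\beta\colon A^{\mathrm{op}}\to H$ with $\alpha(a)\beta(b)=\beta(b)\alpha(a)$ for all $a,b\in A$. An $A$-coring $(H,\Delta,\epsilon)$ is an $A$-bimodule $H$ with $A$-bimodule maps $\Delta\colon H\to H\otimes_A H$ (coassociative) and $\epsilon\colon H\to A$ (counit for $\Delta$). Conditions: (C1) the $A$-bimodule structure of the coring $H$ is $a.h.b=\alpha(a)\beta(b)h$; (C2) the formula $h\triangleright a:=\epsilon(h\alpha(a))$ (extended linearly) defines an action $H\otimes A\to A$. Let $\pi\colon H\otimes H\to H\otimes_A H$ be the projection and $I_A=\operatorname{Ker}\pi$, the right ideal of $H\otimes H$ generated by all $\beta(a)\otimes1-1\otimes\alpha(a)$, $a\in A$. The Takeuchi product is $H\times_A H=\{\sum_i b_i\otimes b_i'\in H\otimes_A H\mid \sum_i b_i\otimes b_i'\alpha(a)=\sum_i b_i\beta(a)\otimes b_i'\ \text{for all } a\in A\}$. **Left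 associative $A$-bialgebroid.** A tuple $(H,\mu,\alpha,\beta,\Delta,\epsilon)$ consisting of an $A\otimes A^{\mathrm{op}}$-ring $(H,\mu,\alpha,\beta)$ and an $A$-coring $(H,\Delta,\epsilon)$ with the same underlying $A$-bimodule $H$, satisfying (C1), (C2) and (C3): the map $H\otimes(H\otimes H)\to H\otimes_A H$, $h\otimes(g\otimes f)\mapsto\Delta(h)(g\otimes f)$ (multiply any representative of $\Delta(h)$ in $H\otimes H$ componentwise by $g\otimes f$ from the right and project) factors through a map $H\otimes(H\otimes_A H)\to H\otimes_A H$ which is a unital action. **Left $A$-bialgebroid with balancing subalgebra $\mathcal B$.** An $A\otimes A^{\mathrm{op}}$-ring $(H,\mu,\alpha,\beta)$ and an $A$-coring $(H,\Delta,\epsilon)$ with the same underlying $A$-bimodule $H$, satisfying (C1) and (C2), together with a (not necessarily unital) subalgebra $\mathcal{B}\subset H\otimes H$, called the balancing subalgebra, such that, viewing $\mathcal{B}/(I_A\cap\mathcal{B})$ as the subspace $\pi(\mathcal{B})$ of $H\otimes_A H$: (C3MI) $I_A\cap\mathcal{B}$ is a two-sided ideal in $\mathcal{B}$; (C3Ma) $\mathrm{Im}\,\Delta\subset\mathcal{B}/(I_A\cap\mathcal{B})$; (C3Mb) $\Delta$ as a map from $H$ to $\mathcal{B}/(I_A\cap\mathcal{B})$ is a homomorphism of algebras. **Hopf $A$-algebroid with balancing subalgebra $\mathcal{B}$.** A left $A$-bialgebroid $(H,\mu,\alpha,\beta,\Delta,\epsilon)$ with balancing subalgebra $\mathcal B$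 together with an algebra antihomomorphism $\tau\colon H\to H$, called the antipode, such that $\mu(\mathrm{id}\otimes_{\bm k}\tau)(I_A\cap\mathcal{B})=0$; $\tau\beta=\alpha$; $\mu(\mathrm{id}\otimes_A\tau)\Delta=\alpha\epsilon$; $\mu(\tau\otimes_A\mathrm{id})\Delta=\beta\epsilon\tau$. Here $\mu(\mathrm{id}\otimes_A\tau)\Delta(h)$ is computed by applying $\mu(\mathrm{id}\otimes_{\bm k}\tau)$ to a representative of $\Delta(h)$ in $\mathcal{B}$ (this makes sense because $\mu(\mathrm{id}\otimes_{\bm k}\tau)(I_A\cap\mathcal{B})=0$), and $\mu(\tau\otimes_A\mathrm{id})$ is well defined on $H\otimes_AH$ because $\tau\beta=\alpha$. **Lu-Hopf algebroid** (Hopf $A$-algebroid in the sense of J.-H. Lu). A left associative $A$-bialgebroid $(H,\mu,\alpha,\beta,\Delta,\epsilon)$ with an antipode map $\tau\colon H\to H$, which is a linear antiautomorphism satisfying $\tau\beta=\alpha$, $\mu(\mathrm{id}\otimes_{\bm k}\tau)\gamma\Delta=\alpha\epsilon$ and $\mu(\tau\otimes_A\mathrm{id})\Delta=\beta\epsilon\tau$ for some linear section $\gamma\colon H\otimes_A H\to H\otimes H$ of the projection $\pi$.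
   Formalization: The coproduct is assumed unital, Δ(1)=1⊗1, as the conclusion forces; the Lu antipode is proved to be a linear antihomomorphism satisfying all other Lu axioms, and an antiautomorphism only if the given antipode is bijective (false otherwise, e.g. Hopf algebras with non-bijective antipode). *)

theory Defs
  imports Complex_Main "HOL-Library.Poly_Mapping"
begin

section \<open>Algebras over a field\<close>

text \<open>The sort \<open>{ring, monoid_mult}\<close> is used instead of \<open>ring_1\<close> so that the zero algebra is allowed.\<close>

locale k_algebra = vector_space scale
  for scale :: "'k::field \<Rightarrow> 'b::{ring,monoid_mult} \<Rightarrow> 'b" +
  assumes scale_mult_left: "scale c x * y = scale c (x * y)"
    and scale_mult_right: "x * scale c y = scale c (x * y)"

definition algebra_hom ::
  "('k::field \<Rightarrow> 'b \<Rightarrow> 'b) \<Rightarrow> ('k \<Rightarrow> 'c \<Rightarrow> 'c) \<Rightarrow> ('b::{ring,monoid_mult} \<Rightarrow> 'c::{ring,monoid_mult}) \<Rightarrow> bool"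
  where "algebra_hom s t f \<longleftrightarrow>
    Vector_Spaces.linear s t f \<and> f 1 = 1 \<and> (\<forall>x y. f (x * y) = f x * f y)"

definition algebra_antihom ::
  "('k::field \<Rightarrow> 'b \<Rightarrow> 'b) \<Rightarrow> ('k \<Rightarrow> 'c \<Rightarrow> 'c) \<Rightarrow> ('b::{ring,monoid_mult} \<Rightarrow> 'c::{ring,monoid_mult}) \<Rightarrow> bool"
  where "algebra_antihom s t f \<longleftrightarrow>
    Vector_Spaces.linear s t f \<and> f 1 = 1 \<and> (\<forall>x y. f (x * y) = f y * f x)"


section \<open>Tensor products as quotients of free vector spaces\<close>

text \<open>
  The free vector space on a basis \<open>'i\<close> is the type of finitely supported functions \<open>'i \<Rightarrow>\<^sub>0 'k\<close>.
  Tensor products are its quotients by a subspace \<open>R\<close>; elements of a quotient are cosets.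
\<close>

definition fscale :: "'k::field \<Rightarrow> ('i \<Rightarrow>\<^sub>0 'k) \<Rightarrow> ('i \<Rightarrow>\<^sub>0 'k)"
  where "fscale c p = Poly_Mapping.map ((*) c) p"

abbreviation pure :: "'i \<Rightarrow> ('i \<Rightarrow>\<^sub>0 'k::field)"
  where "pure i \<equiv> Poly_Mapping.single i 1"

definition lin_ext :: "('k::field \<Rightarrow> 'v \<Rightarrow> 'v) \<Rightarrow> ('i \<Rightarrow> 'v::ab_group_add) \<Rightarrow> ('i \<Rightarrow>\<^sub>0 'k) \<Rightarrow> 'v"
  where "lin_ext s f p = (\<Sum>i\<in>Poly_Mapping.keys p. s (Poly_Mapping.lookup p i) (f i))"

definition qcls :: "('i \<Rightarrow>\<^sub>0 'k::field) set \<Rightarrow> ('i \<Rightarrow>\<^sub>0 'k) \<Rightarrow> ('i \<Rightarrow>\<^sub>0 'k) set"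
  where "qcls R p = {q. q - p \<in> R}"

definition qspace :: "('i \<Rightarrow>\<^sub>0 'k::field) set \<Rightarrow> ('i \<Rightarrow>\<^sub>0 'k) set set"
  where "qspace R = range (qcls R)"

definition qadd ::
  "('i \<Rightarrow>\<^sub>0 'k::field) set \<Rightarrow> ('i \<Rightarrow>\<^sub>0 'k) set \<Rightarrow> ('i \<Rightarrow>\<^sub>0 'k) set \<Rightarrow> ('i \<Rightarrow>\<^sub>0 'k) set"
  where "qadd R X Y = (\<Union>p\<in>X. \<Union>q\<in>Y. qcls R (p + q))"

text \<open>The map into the quotient by \<open>R\<close> induced by \<open>f\<close> on representatives.\<close>

definition qlift ::
  "('j \<Rightarrow>\<^sub>0 'k::field) set \<Rightarrow> (('i \<Rightarrow>\<^sub>0 'k) \<Rightarrow> ('j \<Rightarrow>\<^sub>0 'k)) \<Rightarrow> ('i \<Rightarrow>\<^sub>0 'k) set \<Rightarrow> ('j \<Rightarrow>\<^sub>0 'k) set"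
  where "qlift R f X = (\<Union>p\<in>X. qcls R (f p))"

definition qscale :: "('i \<Rightarrow>\<^sub>0 'k::field) set \<Rightarrow> 'k \<Rightarrow> ('i \<Rightarrow>\<^sub>0 'k) set \<Rightarrow> ('i \<Rightarrow>\<^sub>0 'k) set"
  where "qscale R c = qlift R (fscale c)"

text \<open>The map from a quotient to the vector space \<open>('v, s)\<close> induced by the linear extension of \<open>f\<close>.\<close>

definition qeval ::
  "('k::field \<Rightarrow> 'v \<Rightarrow> 'v) \<Rightarrow> ('i \<Rightarrow> 'v::ab_group_add) \<Rightarrow> ('i \<Rightarrow>\<^sub>0 'k) set \<Rightarrow> 'v"
  where "qeval s f X = the_elem (lin_ext s f ` X)"

definition linear_to_quot ::
  "('k::field \<Rightarrow> 'v \<Rightarrow> 'v) \<Rightarrow> ('i \<Rightarrow>\<^sub>0 'k) set \<Rightarrow> ('v::ab_group_add \<Rightarrow> ('i \<Rightarrow>\<^sub>0 'k) set) \<Rightarrow> bool"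
  where "linear_to_quot s R f \<longleftrightarrow>
    (\<forall>x. f x \<in> qspace R) \<and>
    (\<forall>x y. f (x + y) = qadd R (f x) (f y)) \<and>
    (\<forall>c x. f (s c x) = qscale R c (f x))"

definition linear_quot_quot ::
  "('i \<Rightarrow>\<^sub>0 'k::field) set \<Rightarrow> ('j \<Rightarrow>\<^sub>0 'k) set \<Rightarrow> (('i \<Rightarrow>\<^sub>0 'k) set \<Rightarrow> ('j \<Rightarrow>\<^sub>0 'k) set) \<Rightarrow> bool"
  where "linear_quot_quot R R' f \<longleftrightarrow>
    (\<forall>X\<in>qspace R. f X \<in> qspace R') \<and>
    (\<forall>X\<in>qspace R. \<forall>Y\<in>qspace R. f (qadd R X Y) = qadd R' (f X) (f Y)) \<and>
    (\<forall>c. \<forall>X\<in>qspace R. f (qscale R c X) = qscale R' c (f X))"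

definition bilinear_gens :: "('k::field \<Rightarrow> 'm::ab_group_add \<Rightarrow> 'm) \<Rightarrow> ('m \<times> 'm \<Rightarrow>\<^sub>0 'k) set"
  where "bilinear_gens s =
    {pure (x + x', y) - pure (x, y) - pure (x', y) | x x' y. True} \<union>
    {pure (x, y + y') - pure (x, y) - pure (x, y') | x y y'. True} \<union>
    {pure (s c x, y) - fscale c (pure (x, y)) | c x y. True} \<union>
    {pure (x, s c y) - fscale c (pure (x, y)) | c x y. True}"

text \<open>\<open>qspace (tens_rel s)\<close> is the tensor square of the vector space \<open>('m, s)\<close> over the field.\<close>

definition tens_rel :: "('k::field \<Rightarrow> 'm::ab_group_add \<Rightarrow> 'm) \<Rightarrow> ('m \<times> 'm \<Rightarrow>\<^sub>0 'k) set"
  where "tens_rel s = module.span fscale (bilinear_gens s)"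

text \<open>\<open>qspace (btens_rel s la ra)\<close> is the tensor square over \<open>A\<close> of the \<open>A\<close>-bimodule \<open>'m\<close> with left
  action \<open>la\<close> and right action \<open>ra\<close>.\<close>

definition btens_rel ::
  "('k::field \<Rightarrow> 'm \<Rightarrow> 'm) \<Rightarrow> ('a \<Rightarrow> 'm \<Rightarrow> 'm) \<Rightarrow> ('m \<Rightarrow> 'a \<Rightarrow> 'm::ab_group_add) \<Rightarrow> ('m \<times> 'm \<Rightarrow>\<^sub>0 'k) set"
  where "btens_rel s la ra = module.span fscale
    (bilinear_gens s \<union> {pure (ra x a, y) - pure (x, la a y) | x a y. True})"

text \<open>\<open>p \<otimes> z\<close> and \<open>x \<otimes> q\<close> for formal sums \<open>p\<close>, \<open>q\<close> of pairs.\<close>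

definition tens_right :: "('m \<times> 'm \<Rightarrow>\<^sub>0 'k::field) \<Rightarrow> 'm \<Rightarrow> ('m \<times> 'm \<times> 'm \<Rightarrow>\<^sub>0 'k)"
  where "tens_right p z = lin_ext fscale (\<lambda>(x, y). pure (x, y, z)) p"

definition tens_left :: "'m \<Rightarrow> ('m \<times> 'm \<Rightarrow>\<^sub>0 'k::field) \<Rightarrow> ('m \<times> 'm \<times> 'm \<Rightarrow>\<^sub>0 'k)"
  where "tens_left x q = lin_ext fscale (\<lambda>(y, z). pure (x, y, z)) q"

text \<open>The relations of the triple tensor product over \<open>A\<close>.\<close>

definition btens3_rel ::
  "('k::field \<Rightarrow> 'm \<Rightarrow> 'm) \<Rightarrow> ('a \<Rightarrow> 'm \<Rightarrow> 'm) \<Rightarrow> ('m \<Rightarrow> 'a \<Rightarrow> 'm::ab_group_add) \<Rightarrow>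
    ('m \<times> 'm \<times> 'm \<Rightarrow>\<^sub>0 'k) set"
  where "btens3_rel s la ra = module.span fscale
    ({tens_right r z | r z. r \<in> btens_rel s la ra} \<union> {tens_left x r | x r. r \<in> btens_rel s la ra})"


section \<open>Bimodules and corings\<close>

locale bimodule = A: k_algebra sA + M: vector_space s
  for sA :: "'k::field \<Rightarrow> 'a::{ring,monoid_mult} \<Rightarrow> 'a"
    and s :: "'k \<Rightarrow> 'm::ab_group_add \<Rightarrow> 'm"
    and la :: "'a \<Rightarrow> 'm \<Rightarrow> 'm"
    and ra :: "'m \<Rightarrow> 'a \<Rightarrow> 'm" +
  assumes la_linear: "Vector_Spaces.linear s s (la a)" "Vector_Spaces.linear sA s (\<lambda>a. la a x)"
    and ra_linear: "Vector_Spaces.linear s s (\<lambda>x. ra x a)" "Vector_Spaces.linear sA s (ra x)"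
    and la_one: "la 1 x = x"
    and la_mult: "la (a * b) x = la a (la b x)"
    and ra_one: "ra x 1 = x"
    and ra_mult: "ra x (a * b) = ra (ra x a) b"
    and la_ra: "ra (la a x) b = la a (ra x b)"

text \<open>In \<open>coassoc\<close>, \<open>\<rho>\<close> is a choice of representatives of the values of \<open>\<Delta>\<close>, used to compute
  \<open>(\<Delta> \<otimes> id) \<Delta>\<close> and \<open>(id \<otimes> \<Delta>) \<Delta>\<close>.\<close>

locale coring = bimodule sA s la ra
  for sA :: "'k::field \<Rightarrow> 'a::{ring,monoid_mult} \<Rightarrow> 'a"
    and s :: "'k \<Rightarrow> 'm::ab_group_add \<Rightarrow> 'm"
    and la :: "'a \<Rightarrow> 'm \<Rightarrow> 'm"
    and ra :: "'m \<Rightarrow> 'a \<Rightarrow> 'm" +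
  fixes \<Delta> :: "'m \<Rightarrow> ('m \<times> 'm \<Rightarrow>\<^sub>0 'k) set"
    and \<epsilon> :: "'m \<Rightarrow> 'a"
  assumes comult_linear: "linear_to_quot s (btens_rel s la ra) \<Delta>"
    and comult_la: "\<Delta> (la a h) =
      qlift (btens_rel s la ra) (lin_ext fscale (\<lambda>(x, y). pure (la a x, y))) (\<Delta> h)"
    and comult_ra: "\<Delta> (ra h a) =
      qlift (btens_rel s la ra) (lin_ext fscale (\<lambda>(x, y). pure (x, ra y a))) (\<Delta> h)"
    and coassoc: "(\<And>x. \<rho> x \<in> \<Delta> x) \<Longrightarrow>
      qcls (btens3_rel s la ra) (lin_ext fscale (\<lambda>(x, y). tens_right (\<rho> x) y) (\<rho> h)) =
      qcls (btens3_rel s la ra) (lin_ext fscale (\<lambda>(x, y). tens_left x (\<rho> y)) (\<rho> h))"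
    and counit_linear: "Vector_Spaces.linear s sA \<epsilon>"
    and counit_la: "\<epsilon> (la a h) = a * \<epsilon> h"
    and counit_ra: "\<epsilon> (ra h a) = \<epsilon> h * a"
    and counit_left: "qeval s (\<lambda>(x, y). la (\<epsilon> x) y) (\<Delta> h) = h"
    and counit_right: "qeval s (\<lambda>(x, y). ra x (\<epsilon> y)) (\<Delta> h) = h"


section \<open>The algebra of tensors and the Takeuchi product\<close>

text \<open>Multiplication on the tensor square of \<open>H\<close> over the field.\<close>

definition fmult :: "('h \<times> 'h \<Rightarrow>\<^sub>0 'k::field) \<Rightarrow> ('h \<times> 'h \<Rightarrow>\<^sub>0 'k) \<Rightarrow> ('h::times \<times> 'h \<Rightarrow>\<^sub>0 'k)"
  where "fmult p q =
    lin_ext fscale (\<lambda>(x, y). lin_ext fscale (\<lambda>(x', y'). pure (x * x', y * y')) q) p"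

definition tmult ::
  "('k::field \<Rightarrow> 'h \<Rightarrow> 'h) \<Rightarrow> ('h \<times> 'h \<Rightarrow>\<^sub>0 'k) set \<Rightarrow> ('h \<times> 'h \<Rightarrow>\<^sub>0 'k) set \<Rightarrow> ('h::ring \<times> 'h \<Rightarrow>\<^sub>0 'k) set"
  where "tmult s X Y = (\<Union>p\<in>X. \<Union>q\<in>Y. qcls (tens_rel s) (fmult p q))"

text \<open>The tensor square over \<open>A\<close> of \<open>H\<close> with the bimodule structure \<open>a.h.b = \<alpha> a * \<beta> b * h\<close>,
  the projection onto it, and the kernel of the projection.\<close>

definition tens_relA ::
  "('k::field \<Rightarrow> 'h \<Rightarrow> 'h) \<Rightarrow> ('a \<Rightarrow> 'h) \<Rightarrow> ('a \<Rightarrow> 'h::ring) \<Rightarrow> ('h \<times> 'h \<Rightarrow>\<^sub>0 'k) set"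
  where "tens_relA s \<alpha> \<beta> = btens_rel s (\<lambda>a h. \<alpha> a * h) (\<lambda>h a. \<beta> a * h)"

definition tproj ::
  "('k::field \<Rightarrow> 'h \<Rightarrow> 'h) \<Rightarrow> ('a \<Rightarrow> 'h) \<Rightarrow> ('a \<Rightarrow> 'h::ring) \<Rightarrow>
    ('h \<times> 'h \<Rightarrow>\<^sub>0 'k) set \<Rightarrow> ('h \<times> 'h \<Rightarrow>\<^sub>0 'k) set"
  where "tproj s \<alpha> \<beta> X = qlift (tens_relA s \<alpha> \<beta>) (\<lambda>p. p) X"

definition I_A ::
  "('k::field \<Rightarrow> 'h \<Rightarrow> 'h) \<Rightarrow> ('a \<Rightarrow> 'h) \<Rightarrow> ('a \<Rightarrow> 'h::ring) \<Rightarrow> ('h \<times> 'h \<Rightarrow>\<^sub>0 'k) set set"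
  where "I_A s \<alpha> \<beta> = {X \<in> qspace (tens_rel s). tproj s \<alpha> \<beta> X = qcls (tens_relA s \<alpha> \<beta>) 0}"

definition takeuchi ::
  "('k::field \<Rightarrow> 'h \<Rightarrow> 'h) \<Rightarrow> ('a \<Rightarrow> 'h) \<Rightarrow> ('a \<Rightarrow> 'h::ring) \<Rightarrow> ('h \<times> 'h \<Rightarrow>\<^sub>0 'k) set set"
  where "takeuchi s \<alpha> \<beta> = {Z \<in> qspace (tens_relA s \<alpha> \<beta>). \<forall>a.
    qlift (tens_relA s \<alpha> \<beta>) (lin_ext fscale (\<lambda>(x, y). pure (x, y * \<alpha> a))) Z =
    qlift (tens_relA s \<alpha> \<beta>) (lin_ext fscale (\<lambda>(x, y). pure (x * \<beta> a, y))) Z}"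


section \<open>Bialgebroids and Hopf algebroids\<close>

text \<open>The \<open>A \<otimes> A\<^sup>o\<^sup>p\<close>-ring \<open>(H, \<alpha>, \<beta>)\<close>.\<close>

locale AAop_ring = A: k_algebra sA + H: k_algebra s
  for sA :: "'k::field \<Rightarrow> 'a::{ring,monoid_mult} \<Rightarrow> 'a"
    and s :: "'k \<Rightarrow> 'h::{ring,monoid_mult} \<Rightarrow> 'h" +
  fixes \<alpha> \<beta> :: "'a \<Rightarrow> 'h"
  assumes source_hom: "algebra_hom sA s \<alpha>"
    and target_antihom: "algebra_antihom sA s \<beta>"
    and source_target_commute: "\<alpha> a * \<beta> b = \<beta> b * \<alpha> a"

text \<open>Condition (C1) is the choice of the bimodule structure in the coring; (C2) says that
  \<open>h \<triangleright> a = \<epsilon> (h * \<alpha> a)\<close> is a (unital) action, whose bilinearity is automatic.\<close>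

locale bialgebroid_data =
  AAop_ring sA s \<alpha> \<beta> + coring sA s "\<lambda>a h. \<alpha> a * h" "\<lambda>h a. \<beta> a * h" \<Delta> \<epsilon>
  for sA :: "'k::field \<Rightarrow> 'a::{ring,monoid_mult} \<Rightarrow> 'a"
    and s :: "'k \<Rightarrow> 'h::{ring,monoid_mult} \<Rightarrow> 'h"
    and \<alpha> \<beta> :: "'a \<Rightarrow> 'h"
    and \<Delta> :: "'h \<Rightarrow> ('h \<times> 'h \<Rightarrow>\<^sub>0 'k) set"
    and \<epsilon> :: "'h \<Rightarrow> 'a" +
  assumes C2_one: "\<epsilon> (1 * \<alpha> a) = a"
    and C2_mult: "\<epsilon> ((g * h) * \<alpha> a) = \<epsilon> (g * \<alpha> (\<epsilon> (h * \<alpha> a)))"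

text \<open>In \<open>C3\<close>, \<open>X\<close> is an arbitrary tensor over the field and \<open>Y\<close> an arbitrary representative of
  \<open>\<Delta> h\<close>; \<open>act\<close> is the factored map.\<close>

locale left_bialgebroid = bialgebroid_data sA s \<alpha> \<beta> \<Delta> \<epsilon>
  for sA :: "'k::field \<Rightarrow> 'a::{ring,monoid_mult} \<Rightarrow> 'a"
    and s :: "'k \<Rightarrow> 'h::{ring,monoid_mult} \<Rightarrow> 'h"
    and \<alpha> \<beta> :: "'a \<Rightarrow> 'h"
    and \<Delta> :: "'h \<Rightarrow> ('h \<times> 'h \<Rightarrow>\<^sub>0 'k) set"
    and \<epsilon> :: "'h \<Rightarrow> 'a" +
  assumes C3: "\<exists>act.
    (\<forall>h. linear_quot_quot (tens_relA s \<alpha> \<beta>) (tens_relA s \<alpha> \<beta>) (act h)) \<and>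
    (\<forall>Z\<in>qspace (tens_relA s \<alpha> \<beta>). linear_to_quot s (tens_relA s \<alpha> \<beta>) (\<lambda>h. act h Z)) \<and>
    (\<forall>h. \<forall>X\<in>qspace (tens_rel s). \<forall>Y\<in>qspace (tens_rel s). tproj s \<alpha> \<beta> Y = \<Delta> h \<longrightarrow>
      act h (tproj s \<alpha> \<beta> X) = tproj s \<alpha> \<beta> (tmult s Y X)) \<and>
    (\<forall>Z\<in>qspace (tens_relA s \<alpha> \<beta>). act 1 Z = Z) \<and>
    (\<forall>g h. \<forall>Z\<in>qspace (tens_relA s \<alpha> \<beta>). act (g * h) Z = act g (act h Z))"

text \<open>\<open>C3Mb\<close>: the product of \<open>tproj Y\<close> and \<open>tproj Y'\<close> in \<open>\<B> / (I_A \<inter> \<B>)\<close>, for \<open>Y\<close> and \<open>Y'\<close> in \<open>\<B>\<close>,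
  is \<open>tproj (Y * Y')\<close>. As \<open>H\<close> is unital, a homomorphism \<open>\<Delta>\<close> of algebras maps \<open>1\<close> to \<open>1 \<otimes> 1\<close>;
  since \<open>\<B>\<close> need not be unital, this has to be said separately in \<open>C3Mb_one\<close>.\<close>

locale balanced_bialgebroid = bialgebroid_data sA s \<alpha> \<beta> \<Delta> \<epsilon>
  for sA :: "'k::field \<Rightarrow> 'a::{ring,monoid_mult} \<Rightarrow> 'a"
    and s :: "'k \<Rightarrow> 'h::{ring,monoid_mult} \<Rightarrow> 'h"
    and \<alpha> \<beta> :: "'a \<Rightarrow> 'h"
    and \<Delta> :: "'h \<Rightarrow> ('h \<times> 'h \<Rightarrow>\<^sub>0 'k) set"
    and \<epsilon> :: "'h \<Rightarrow> 'a" +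
  fixes \<B> :: "('h \<times> 'h \<Rightarrow>\<^sub>0 'k) set set"
  assumes bal_subset: "\<B> \<subseteq> qspace (tens_rel s)"
    and bal_zero: "qcls (tens_rel s) 0 \<in> \<B>"
    and bal_add: "\<lbrakk>X \<in> \<B>; Y \<in> \<B>\<rbrakk> \<Longrightarrow> qadd (tens_rel s) X Y \<in> \<B>"
    and bal_scale: "X \<in> \<B> \<Longrightarrow> qscale (tens_rel s) c X \<in> \<B>"
    and bal_mult: "\<lbrakk>X \<in> \<B>; Y \<in> \<B>\<rbrakk> \<Longrightarrow> tmult s X Y \<in> \<B>"
    and C3MI: "\<lbrakk>X \<in> I_A s \<alpha> \<beta> \<inter> \<B>; Y \<in> \<B>\<rbrakk> \<Longrightarrow>
      tmult s X Y \<in> I_A s \<alpha> \<beta> \<inter> \<B> \<and> tmult s Y X \<in> I_A s \<alpha> \<beta> \<inter> \<B>"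
    and C3Ma: "range \<Delta> \<subseteq> tproj s \<alpha> \<beta> ` \<B>"
    and C3Mb_mult: "\<lbrakk>Y \<in> \<B>; Y' \<in> \<B>; tproj s \<alpha> \<beta> Y = \<Delta> g; tproj s \<alpha> \<beta> Y' = \<Delta> h\<rbrakk> \<Longrightarrow>
      \<Delta> (g * h) = tproj s \<alpha> \<beta> (tmult s Y Y')"
    and C3Mb_one: "\<Delta> 1 = qcls (tens_relA s \<alpha> \<beta>) (pure (1, 1))"

locale balanced_hopf_algebroid = balanced_bialgebroid sA s \<alpha> \<beta> \<Delta> \<epsilon> \<B>
  for sA :: "'k::field \<Rightarrow> 'a::{ring,monoid_mult} \<Rightarrow> 'a"
    and s :: "'k \<Rightarrow> 'h::{ring,monoid_mult} \<Rightarrow> 'h"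
    and \<alpha> \<beta> :: "'a \<Rightarrow> 'h"
    and \<Delta> :: "'h \<Rightarrow> ('h \<times> 'h \<Rightarrow>\<^sub>0 'k) set"
    and \<epsilon> :: "'h \<Rightarrow> 'a"
    and \<B> :: "('h \<times> 'h \<Rightarrow>\<^sub>0 'k) set set" +
  fixes \<tau> :: "'h \<Rightarrow> 'h"
  assumes antipode_antihom: "algebra_antihom s s \<tau>"
    and antipode_balancing: "X \<in> I_A s \<alpha> \<beta> \<inter> \<B> \<Longrightarrow> qeval s (\<lambda>(x, y). x * \<tau> y) X = 0"
    and antipode_target: "\<tau> (\<beta> a) = \<alpha> a"
    and antipode_right: "\<lbrakk>X \<in> \<B>; tproj s \<alpha> \<beta> X = \<Delta> h\<rbrakk> \<Longrightarrow> qeval s (\<lambda>(x, y). x * \<tau> y) X = \<alpha> (\<epsilon> h)"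
    and antipode_left: "qeval s (\<lambda>(x, y). \<tau> x * y) (\<Delta> h) = \<beta> (\<epsilon> (\<tau> h))"

text \<open>All the axioms of a Hopf algebroid in the sense of Lu except bijectivity of the antipode.\<close>

locale weak_lu_hopf_algebroid = left_bialgebroid sA s \<alpha> \<beta> \<Delta> \<epsilon>
  for sA :: "'k::field \<Rightarrow> 'a::{ring,monoid_mult} \<Rightarrow> 'a"
    and s :: "'k \<Rightarrow> 'h::{ring,monoid_mult} \<Rightarrow> 'h"
    and \<alpha> \<beta> :: "'a \<Rightarrow> 'h"
    and \<Delta> :: "'h \<Rightarrow> ('h \<times> 'h \<Rightarrow>\<^sub>0 'k) set"
    and \<epsilon> :: "'h \<Rightarrow> 'a" +
  fixes \<tau> :: "'h \<Rightarrow> 'h"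
  assumes antipode_antihom: "algebra_antihom s s \<tau>"
    and antipode_target: "\<tau> (\<beta> a) = \<alpha> a"
    and antipode_right: "\<exists>\<gamma>. linear_quot_quot (tens_relA s \<alpha> \<beta>) (tens_rel s) \<gamma> \<and>
      (\<forall>Z\<in>qspace (tens_relA s \<alpha> \<beta>). tproj s \<alpha> \<beta> (\<gamma> Z) = Z) \<and>
      (\<forall>h. qeval s (\<lambda>(x, y). x * \<tau> y) (\<gamma> (\<Delta> h)) = \<alpha> (\<epsilon> h))"
    and antipode_left: "qeval s (\<lambda>(x, y). \<tau> x * y) (\<Delta> h) = \<beta> (\<epsilon> (\<tau> h))"

locale lu_hopf_algebroid = weak_lu_hopf_algebroid sA s \<alpha> \<beta> \<Delta> \<epsilon> \<tau>
  for sA :: "'k::field \<Rightarrow> 'a::{ring,monoid_mult} \<Rightarrow> 'a"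
    and s :: "'k \<Rightarrow> 'h::{ring,monoid_mult} \<Rightarrow> 'h"
    and \<alpha> \<beta> :: "'a \<Rightarrow> 'h"
    and \<Delta> :: "'h \<Rightarrow> ('h \<times> 'h \<Rightarrow>\<^sub>0 'k) set"
    and \<epsilon> :: "'h \<Rightarrow> 'a"
    and \<tau> :: "'h \<Rightarrow> 'h" +
  assumes antipode_bij: "bij \<tau>"

end

theory Submission
  imports Defs
begin

text \<open>
  If \<open>\<Delta> h\<close> lies in the Takeuchi product, left multiplication by a representative of \<open>\<Delta> h\<close> preserves
  the right ideal \<open>I\<^sub>A\<close>, so \<open>H\<close> acts on \<open>H \<otimes>\<^sub>A H\<close>; multiplicativity of the action is read off on
  representatives in the balancing subalgebra \<open>\<B>\<close>, where \<open>\<Delta>\<close> is multiplicative. Since \<open>\<Delta>\<close> takes values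
  in \<open>\<pi> \<B>\<close>, any linear section of \<open>\<pi>\<close> that maps \<open>\<pi> \<B>\<close> into \<open>\<B>\<close> serves as \<open>\<gamma>\<close>; the antipode stays the same.
\<close>

section \<open>Free vector spaces and linear extension\<close>

lemma lookup_fscale [simp]: "Poly_Mapping.lookup (fscale c p) i = c * Poly_Mapping.lookup p i"
  by (simp add: fscale_def map.rep_eq when_def)

interpretation free: vector_space "fscale :: 'k::field \<Rightarrow> ('i \<Rightarrow>\<^sub>0 'k) \<Rightarrow> _"
  by unfold_locales
    (auto intro!: poly_mapping_eqI simp: lookup_add algebra_simps)

lemma fscale_single [simp]: "fscale c (Poly_Mapping.single i d) = Poly_Mapping.single i (c * d)"
  by (auto intro!: poly_mapping_eqI simp: lookup_single when_def)

text \<open>A formal sum is a finite sum of scaled basis elements, so identities linear in it reduce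
  to \<open>pure\<close>.\<close>

lemma free_induct [case_names zero pure add scale]:
  fixes p :: "'i \<Rightarrow>\<^sub>0 'k::field"
  assumes "P 0" "\<And>i. P (pure i)" "\<And>p q. \<lbrakk>P p; P q\<rbrakk> \<Longrightarrow> P (p + q)"
    and "\<And>c p. P p \<Longrightarrow> P (fscale c p)"
  shows "P p"
proof -
  have single: "P (Poly_Mapping.single i c)" for i c
    using assms(4)[OF assms(2)[of i], of c] by simp
  have "P (\<Sum>i\<in>S. Poly_Mapping.single i (Poly_Mapping.lookup p i))" for S
    by (induction S rule: infinite_finite_induct) (auto intro: assms single)
  moreover have "(\<Sum>i\<in>Poly_Mapping.keys p. Poly_Mapping.single i (Poly_Mapping.lookup p i)) = p"
    by (rule poly_mapping_eqI) (auto simp: lookup_sum lookup_single when_def sum.delta' in_keys_iff)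
  ultimately show ?thesis by metis
qed

context vector_space
begin

text \<open>The supports of \<open>p\<close>, \<open>q\<close> and \<open>p + q\<close> differ; over
  one common finite set their sums can be compared, the added terms having coefficient 0.\<close>

lemma lin_ext_superset:
  assumes "finite S" "Poly_Mapping.keys p \<subseteq> S"
  shows "lin_ext scale f p = (\<Sum>i\<in>S. scale (Poly_Mapping.lookup p i) (f i))"
  unfolding lin_ext_def using assms
  by (intro sum.mono_neutral_left) (auto simp: in_keys_iff)

lemma lin_ext_add: "lin_ext scale f (p + q) = lin_ext scale f p + lin_ext scale f q"
proof -
  let ?S = "Poly_Mapping.keys p \<union> Poly_Mapping.keys q"
  have "Poly_Mapping.keys (p + q) \<subseteq> ?S" by (rule Poly_Mapping.keys_add)
  then show ?thesis
    using lin_ext_superset[of ?S p f] lin_ext_superset[of ?S q f] lin_ext_superset[of ?S "p + q" f]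
    by (simp add: lookup_add scale_left_distrib sum.distrib)
qed

lemma lin_ext_scale: "lin_ext scale f (fscale c p) = scale c (lin_ext scale f p)"
proof -
  have "Poly_Mapping.keys (fscale c p) \<subseteq> Poly_Mapping.keys p" by (auto simp: in_keys_iff)
  then show ?thesis
    using lin_ext_superset[of "Poly_Mapping.keys p" "fscale c p" f]
    by (simp add: lin_ext_def scale_sum_right)
qed

lemma lin_ext_pure [simp]: "lin_ext scale f (pure i) = f i"
  by (simp add: lin_ext_def)

lemma lin_ext_fun_add:
  "lin_ext scale (\<lambda>i. f i + g i) p = lin_ext scale f p + lin_ext scale g p"
  by (simp add: lin_ext_def scale_right_distrib sum.distrib)

lemma lin_ext_fun_scale:
  "lin_ext scale (\<lambda>i. scale c (f i)) p = scale c (lin_ext scale f p)"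
  by (simp add: lin_ext_def scale_sum_right mult.commute)

end


section \<open>Quotients\<close>

lemma qcls_eq_iff:
  assumes "free.subspace R"
  shows "qcls R p = qcls R q \<longleftrightarrow> p - q \<in> R"
proof
  assume "qcls R p = qcls R q"
  moreover have "p \<in> qcls R p" using free.subspace_0[OF assms] by (simp add: qcls_def)
  ultimately show "p - q \<in> R" by (auto simp: qcls_def)
next
  assume pq: "p - q \<in> R"
  show "qcls R p = qcls R q"
  proof (unfold qcls_def, intro Collect_cong iffI)
    fix r
    show "r - q \<in> R" if "r - p \<in> R"
      using free.subspace_add[OF assms that pq] by simp
    show "r - p \<in> R" if "r - q \<in> R"
      using free.subspace_diff[OF assms that pq] by simp
  qed
qed

lemma qcls_self: "free.subspace R \<Longrightarrow> p \<in> qcls R p"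
  using free.subspace_0 by (simp add: qcls_def)

lemma qspaceE [elim]:
  assumes "X \<in> qspace R"
  obtains p where "X = qcls R p"
  using assms by (auto simp: qspace_def)

lemma qcls_in_qspace [simp]: "qcls R p \<in> qspace R"
  by (simp add: qspace_def)

text \<open>\<open>qlift\<close> is a union of cosets over all representatives; the last assumption
  makes these cosets equal, so the union is just one of them.\<close>

lemma qlift_qcls:
  assumes "free.subspace R" "free.subspace R'" "\<And>q. q - p \<in> R \<Longrightarrow> f q - f p \<in> R'"
  shows "qlift R' f (qcls R p) = qcls R' (f p)"
proof -
  have "qcls R' (f q) = qcls R' (f p)" if "q \<in> qcls R p" for q
    using that assms(3) by (simp add: qcls_eq_iff[OF assms(2)]) (simp add: qcls_def)
  then show ?thesis unfolding qlift_def using qcls_self[OF assms(1), of p] by blast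
qed

lemma qadd_qcls:
  assumes "free.subspace R"
  shows "qadd R (qcls R p) (qcls R q) = qcls R (p + q)"
proof -
  have "qcls R (p' + q') = qcls R (p + q)" if "p' \<in> qcls R p" "q' \<in> qcls R q" for p' q'
  proof -
    have "(p' - p) + (q' - q) \<in> R"
      using that by (intro free.subspace_add[OF assms]) (auto simp: qcls_def)
    then show ?thesis using assms by (simp add: qcls_eq_iff algebra_simps)
  qed
  then show ?thesis unfolding qadd_def
    using qcls_self[OF assms, of p] qcls_self[OF assms, of q] by blast
qed

lemma qscale_qcls:
  assumes "free.subspace R"
  shows "qscale R c (qcls R p) = qcls R (fscale c p)"
  unfolding qscale_def using assms
  by (intro qlift_qcls) (auto simp: free.scale_right_diff_distrib[symmetric] free.subspace_scale)

lemma linear_quot_quot_qlift: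
  assumes "free.subspace R" "free.subspace R'"
    and f: "Vector_Spaces.linear fscale fscale f" "\<And>r. r \<in> R \<Longrightarrow> f r \<in> R'"
  shows "linear_quot_quot R R' (qlift R' f)"
    and "qlift R' f (qcls R p) = qcls R' (f p)"
proof -
  interpret f: Vector_Spaces.linear fscale fscale f by (rule f)
  show *: "qlift R' f (qcls R p) = qcls R' (f p)" for p
    using assms by (intro qlift_qcls) (auto simp: f.diff[symmetric])
  show "linear_quot_quot R R' (qlift R' f)"
    unfolding linear_quot_quot_def
    by (auto elim!: qspaceE simp: * qadd_qcls qscale_qcls assms f.add f.scale)
qed

section \<open>Relations of the tensor squares over the field and over \<open>A\<close>\<close>

lemma subspace_tens_rel: "free.subspace (tens_rel s)"
  by (simp add: tens_rel_def)

lemma subspace_tens_relA: "free.subspace (tens_relA s \<alpha> \<beta>)"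
  by (simp add: tens_relA_def btens_rel_def)

lemma tens_rel_subset_tens_relA: "tens_rel s \<subseteq> tens_relA s \<alpha> \<beta>"
  unfolding tens_rel_def tens_relA_def btens_rel_def by (intro free.span_mono) auto

lemma tproj_qcls: "tproj s \<alpha> \<beta> (qcls (tens_rel s) p) = qcls (tens_relA s \<alpha> \<beta>) p"
  unfolding tproj_def using tens_rel_subset_tens_relA
  by (intro qlift_qcls subspace_tens_rel subspace_tens_relA) auto

text \<open>A section of the projection \<open>V / T \<rightarrow> V / R\<close> lifts to an endomorphism of \<open>V\<close>: kill a basis of
  \<open>R\<close>, and complete it to a basis of \<open>V\<close> through elements of the subspace \<open>B\<close> first.\<close>

lemma (in vector_space) linear_projection_along:
  assumes R: "subspace R" and B: "subspace B"
  obtains g where "Vector_Spaces.linear scale scale g" "\<And>p. g p - p \<in> R"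
    "\<And>r. r \<in> R \<Longrightarrow> g r = 0" "\<And>b. b \<in> B \<Longrightarrow> g b \<in> B"
proof -
  obtain C where C: "C \<subseteq> R" "independent C" "R \<subseteq> span C"
    by (rule maximal_independent_subset)
  obtain D where D: "C \<subseteq> D" "D \<subseteq> C \<union> B" "independent D" "C \<union> B \<subseteq> span D"
    by (rule maximal_independent_subset_extend[OF Un_upper1 C(2)])
  obtain E where E: "D \<subseteq> E" "E \<subseteq> UNIV" "independent E" "UNIV \<subseteq> span E"
    by (rule maximal_independent_subset_extend[OF subset_UNIV D(3)])
  interpret vs: vector_space_pair scale scale ..
  define g where "g = vs.construct E (\<lambda>b. if b \<in> C then 0 else b)"
  interpret g: Vector_Spaces.linear scale scale g
    unfolding g_def by (rule vs.linear_construct[OF E(3)])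
  have gE: "g b = (if b \<in> C then 0 else b)" if "b \<in> E" for b
    unfolding g_def by (rule vs.construct_basis[OF E(3) that])
  have gC: "g r = 0" if "r \<in> R" for r
  proof -
    have "r \<in> span C" using that C(3) by blast
    then show ?thesis
    proof (induction rule: span_induct_alt)
      case (step c x y)
      then have "x \<in> E" using D(1) E(1) by blast
      then have "g x = 0" using step(1) gE by simp
      then show ?case using step by (simp add: g.add g.scale)
    qed simp
  qed
  \<comment> \<open>On a basis vector \<open>x\<close> the difference is \<open>0\<close>, or
    \<open>- x\<close> with \<open>x\<close> in \<open>C\<close>, hence in \<open>R\<close>;
    linearity does the rest.\<close>
  have diff: "g p - p \<in> R" for p
  proof -
    have "p \<in> span E" using E(4) by blast
    then show ?thesis
    proof (induction rule: span_induct_alt)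
      case base
      show ?case using subspace_0[OF R] by simp
    next
      case (step c x y)
      have "g x - x \<in> R"
        using gE[OF step(1)] C(1) subspace_neg[OF R] subspace_0[OF R] by auto
      then have "scale c (g x - x) + (g y - y) \<in> R"
        using step by (intro subspace_add[OF R] subspace_scale[OF R])
      then show ?case by (simp add: g.add g.scale scale_right_diff_distrib add_diff_add)
    qed
  qed
  \<comment> \<open>\<open>B\<close> lies in the span of \<open>D\<close>, and each vector of
    \<open>D\<close> is either killed or a fixed vector of \<open>B\<close>; this is why the basis
    is built through \<open>D\<close>.\<close>
  have gB: "g b \<in> B" if "b \<in> B" for b
  proof -
    have "b \<in> span D" using that D(4) by blast
    then show ?thesis
    proof (induction rule: span_induct_alt)
      case base
      show ?case using subspace_0[OF B] by simp
    next
      case (step c x y)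
      have "x \<in> E" "x \<in> C \<union> B" using step(1) D(2) E(1) by blast+
      then have "g x \<in> B" using gE[of x] subspace_0[OF B] by auto
      then show ?case using step by (simp add: g.add g.scale subspace_add[OF B] subspace_scale[OF B])
    qed
  qed
  show thesis by (rule that[OF g.linear_axioms diff gC gB])
qed


section \<open>Multiplication of tensors\<close>

lemma fmult_pure [simp]: "fmult (pure (x, y)) (pure (x', y')) = pure (x * x', y * y')"
  by (simp add: fmult_def)

lemma fmult_add_left: "fmult (p + p') q = fmult p q + fmult p' q"
  by (simp add: fmult_def free.lin_ext_add)

lemma fmult_scale_left: "fmult (fscale c p) q = fscale c (fmult p q)"
  by (simp add: fmult_def free.lin_ext_scale)

lemma fmult_add_right: "fmult p (q + q') = fmult p q + fmult p q'"
  by (simp add: fmult_def free.lin_ext_add case_prod_unfold free.lin_ext_fun_add)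

lemma fmult_scale_right: "fmult p (fscale c q) = fscale c (fmult p q)"
  by (simp add: fmult_def free.lin_ext_scale case_prod_unfold free.lin_ext_fun_scale)

lemma linear_fmult_left: "Vector_Spaces.linear fscale fscale (\<lambda>p. fmult p q)"
  by unfold_locales (simp_all add: fmult_add_left fmult_scale_left)

lemma linear_fmult_right: "Vector_Spaces.linear fscale fscale (fmult p)"
  by unfold_locales (simp_all add: fmult_add_right fmult_scale_right)

lemmas fmult_simps =
  fmult_add_left fmult_add_right fmult_scale_left fmult_scale_right
  module_hom.diff[OF module_hom_linearI[OF linear_fmult_left]]
  module_hom.diff[OF module_hom_linearI[OF linear_fmult_right]]
  module_hom.zero[OF module_hom_linearI[OF linear_fmult_left]]
  module_hom.zero[OF module_hom_linearI[OF linear_fmult_right]]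

lemma fmult_assoc:
  fixes p q r :: "'h::{ring,monoid_mult} \<times> 'h \<Rightarrow>\<^sub>0 'k::field"
  shows "fmult (fmult p q) r = fmult p (fmult q r)"
proof (induction p rule: free_induct)
  case (pure i)
  show ?case
  proof (induction q rule: free_induct)
    case (pure j)
    show ?case
      by (induction r rule: free_induct)
        (cases i; cases j; auto simp: fmult_simps mult.assoc)+
  qed (simp_all add: fmult_simps)
qed (simp_all add: fmult_simps)

lemma fmult_one [simp]:
  fixes p :: "'h::{ring,monoid_mult} \<times> 'h \<Rightarrow>\<^sub>0 'k::field"
  shows "fmult (pure (1, 1)) p = p"
proof (induction p rule: free_induct)
  case (pure i)
  show ?case by (cases i) simp
qed (simp_all add: fmult_simps)

text \<open>By bilinearity of \<open>fmult\<close> it is enough to multiply generators by pure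
  tensors.\<close>

lemma fmult_in_span_right:
  assumes "\<And>g x y. g \<in> G \<Longrightarrow> fmult g (pure (x, y)) \<in> free.span G" "r \<in> free.span G"
  shows "fmult r p \<in> free.span G"
proof (induction p rule: free_induct)
  case (pure i)
  obtain x y where i: "i = (x, y)" by (cases i)
  show ?case using assms(2)
    by (induction rule: free.span_induct_alt)
      (auto simp: i fmult_simps free.span_zero intro!: free.span_add free.span_scale assms(1))
qed (auto simp: fmult_simps free.span_zero intro!: free.span_add free.span_scale)

lemma fmult_in_span_left:
  assumes "\<And>g x y. g \<in> G \<Longrightarrow> fmult (pure (x, y)) g \<in> free.span G" "r \<in> free.span G"
  shows "fmult p r \<in> free.span G"
proof (induction p rule: free_induct)
  case (pure i)
  obtain x y where i: "i = (x, y)" by (cases i)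
  show ?case using assms(2)
    by (induction rule: free.span_induct_alt)
      (auto simp: i fmult_simps free.span_zero intro!: free.span_add free.span_scale assms(1))
qed (auto simp: fmult_simps free.span_zero intro!: free.span_add free.span_scale)

section \<open>Ideals of relations and the Takeuchi condition\<close>

context k_algebra
begin

text \<open>Each kind of generator is stable under multiplication by a pure tensor. Stating this for
  generators, not for their span, serves the relations over the field and over \<open>A\<close>
  alike.\<close>

lemma fmult_bilinear_gens_right:
  assumes "g \<in> bilinear_gens scale"
  shows "fmult g (pure (x, y)) \<in> bilinear_gens scale"
  using assms unfolding bilinear_gens_def
  \<comment> \<open>Keeping \<open>fscale\<close> unevaluated leaves the products in the shape of
    the generators.\<close>
  by (elim UnE; clarsimp simp: fmult_simps distrib_left distrib_right scale_mult_left scale_mult_right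
      simp del: fscale_single) blast+

lemma fmult_bilinear_gens_left:
  assumes "g \<in> bilinear_gens scale"
  shows "fmult (pure (x, y)) g \<in> bilinear_gens scale"
  using assms unfolding bilinear_gens_def
  by (elim UnE; clarsimp simp: fmult_simps distrib_left distrib_right scale_mult_left scale_mult_right
      simp del: fscale_single) blast+

lemma fmult_tens_rel_right: "r \<in> tens_rel scale \<Longrightarrow> fmult r p \<in> tens_rel scale"
  unfolding tens_rel_def
  by (rule fmult_in_span_right) (auto intro: free.span_base fmult_bilinear_gens_right)

lemma fmult_tens_rel_left: "r \<in> tens_rel scale \<Longrightarrow> fmult p r \<in> tens_rel scale"
  unfolding tens_rel_def
  by (rule fmult_in_span_left) (auto intro: free.span_base fmult_bilinear_gens_left)

lemma tmult_qcls:
  "tmult scale (qcls (tens_rel scale) p) (qcls (tens_rel scale) q) = qcls (tens_rel scale) (fmult p q)"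
proof -
  let ?T = "tens_rel scale"
  have "qcls ?T (fmult p' q') = qcls ?T (fmult p q)" if "p' \<in> qcls ?T p" "q' \<in> qcls ?T q" for p' q'
  proof -
    have "p' - p \<in> ?T" "q' - q \<in> ?T" using that by (simp_all add: qcls_def)
    \<comment> \<open>The two summands telescope to \<open>fmult p' q' - fmult p q\<close>.\<close>
    then have "fmult (p' - p) q' + fmult p (q' - q) \<in> ?T"
      by (intro free.subspace_add[OF subspace_tens_rel] fmult_tens_rel_left fmult_tens_rel_right)
    then have "fmult p' q' - fmult p q \<in> ?T" by (simp add: fmult_simps)
    then show ?thesis by (simp only: qcls_eq_iff[OF subspace_tens_rel])
  qed
  moreover have "qcls ?T p \<noteq> {}" "qcls ?T q \<noteq> {}" using qcls_self[OF subspace_tens_rel] by blast+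
  ultimately show ?thesis unfolding tmult_def by simp
qed

text \<open>The bimodule actions multiply from the left, so right multiplication turns a balancing
  relation into another one: the kernel is a right ideal.\<close>

lemma fmult_tens_relA_right:
  assumes "r \<in> tens_relA scale \<alpha> \<beta>"
  shows "fmult r p \<in> tens_relA scale \<alpha> \<beta>"
  using assms unfolding tens_relA_def btens_rel_def
proof (rule fmult_in_span_right[rotated], goal_cases)
  case (1 g x y)
  have "fmult (pure (\<beta> a * u, v) - pure (u, \<alpha> a * v)) (pure (x, y)) =
      pure (\<beta> a * (u * x), v * y) - pure (u * x, \<alpha> a * (v * y))" for a u v
    by (simp add: fmult_simps mult.assoc)
  with 1 show ?case
    by (intro free.span_base) (blast intro: fmult_bilinear_gens_right)
qed

text \<open>The kernel of the projection is generated, as a right ideal, by \<open>\<beta> a \<otimes> 1 - 1 \<otimes> \<alpha> a\<close>; an element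
  that multiplies these generators from the left into the kernel therefore multiplies all of it.\<close>

lemma fmult_tens_relA_left:
  assumes p: "\<And>a. fmult p (pure (\<beta> a, 1)) - fmult p (pure (1, \<alpha> a)) \<in> tens_relA scale \<alpha> \<beta>"
    and r: "r \<in> tens_relA scale \<alpha> \<beta>"
  shows "fmult p r \<in> tens_relA scale \<alpha> \<beta>"
  using r[unfolded tens_relA_def btens_rel_def]
proof (induction rule: free.span_induct_alt)
  case base
  show ?case using free.subspace_0 subspace_tens_relA by (auto simp: fmult_simps)
next
  case (step c g q)
  have "fmult p g \<in> tens_relA scale \<alpha> \<beta>"
  proof (cases "g \<in> bilinear_gens scale")
    case True
    then have "g \<in> tens_rel scale" by (simp add: tens_rel_def free.span_base)
    then show ?thesis using fmult_tens_rel_left tens_rel_subset_tens_relA by blast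
  next
    case False
    then obtain x a y where g: "g = pure (\<beta> a * x, y) - pure (x, \<alpha> a * y)" using step by auto
    have "fmult p g = fmult (fmult p (pure (\<beta> a, 1)) - fmult p (pure (1, \<alpha> a))) (pure (x, y))"
      by (simp add: g fmult_simps fmult_assoc)
    then show ?thesis using fmult_tens_relA_right[OF p] by simp
  qed
  then show ?case using step
    by (auto simp: fmult_simps intro!: free.subspace_add free.subspace_scale subspace_tens_relA)
qed

text \<open>Brings the Takeuchi condition into the form that \<open>fmult_tens_relA_left\<close>
  asks of a left factor.\<close>

lemma takeuchi_qclsD:
  assumes "qcls (tens_relA scale \<alpha> \<beta>) p \<in> takeuchi scale \<alpha> \<beta>"
  shows "fmult p (pure (\<beta> a, 1)) - fmult p (pure (1, \<alpha> a)) \<in> tens_relA scale \<alpha> \<beta>"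
proof -
  let ?R = "tens_relA scale \<alpha> \<beta>"
  \<comment> \<open>Free \<open>u\<close> and \<open>v\<close> let one computation cover both sides
    of the Takeuchi condition.\<close>
  have eq: "qlift ?R (lin_ext fscale (\<lambda>(x, y). pure (x * u, y * v))) (qcls ?R p) =
      qcls ?R (fmult p (pure (u, v)))" for u v
  proof -
    have "lin_ext fscale (\<lambda>(x, y). pure (x * u, y * v)) q = fmult q (pure (u, v))"
      for q :: "'b \<times> 'b \<Rightarrow>\<^sub>0 'k"
      by (simp add: fmult_def)
    moreover have "qlift ?R (\<lambda>q. fmult q (pure (u, v))) (qcls ?R p) = qcls ?R (fmult p (pure (u, v)))"
      by (intro linear_quot_quot_qlift subspace_tens_relA linear_fmult_left fmult_tens_relA_right)
    ultimately show ?thesis by presburger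
  qed
  have "qcls ?R (fmult p (pure (\<beta> a, 1))) = qcls ?R (fmult p (pure (1, \<alpha> a)))"
    using assms eq[of 1 "\<alpha> a"] eq[of "\<beta> a" 1] by (simp add: takeuchi_def)
  then show ?thesis using qcls_eq_iff[OF subspace_tens_relA] by metis
qed

end


section \<open>From a balancing subalgebra to a Lu-Hopf algebroid\<close>

context balanced_bialgebroid
begin

abbreviation "R \<equiv> tens_relA s \<alpha> \<beta>"

lemma comult_representative:
  obtains p where "qcls (tens_rel s) p \<in> \<B>" "\<Delta> h = qcls R p"
proof -
  obtain Y where Y: "Y \<in> \<B>" "\<Delta> h = tproj s \<alpha> \<beta> Y" using C3Ma by blast
  then obtain p where "Y = qcls (tens_rel s) p" using bal_subset by blast
  then show thesis using that Y by (simp add: tproj_qcls)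
qed

lemma left_bialgebroid_takeuchi:
  assumes tak: "range \<Delta> \<subseteq> takeuchi s \<alpha> \<beta>"
  shows "left_bialgebroid sA s \<alpha> \<beta> \<Delta> \<epsilon>"
proof -
  have \<Delta>_linear: "linear_to_quot s R \<Delta>"
    using comult_linear by (simp add: tens_relA_def)
  have "\<exists>p. \<Delta> h = qcls R p" for h
    using comult_representative[of h] by blast
  then obtain \<rho> where \<rho>: "\<Delta> h = qcls R (\<rho> h)" for h
    by metis
  define act where "act h = qlift R (fmult (\<rho> h))" for h
  have left: "fmult p r \<in> R" if "\<Delta> h = qcls R p" "r \<in> R" for h p r
    using that tak by (intro H.fmult_tens_relA_left H.takeuchi_qclsD) auto
  \<comment> \<open>Independence of the representative: two of them differ by an element of the
    right ideal \<open>R\<close>.\<close>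
  have act: "act h (qcls R q) = qcls R (fmult p q)" if "\<Delta> h = qcls R p" for h p q
  proof -
    have "act h (qcls R q) = qcls R (fmult (\<rho> h) q)"
      unfolding act_def using left[OF \<rho>]
      by (intro linear_quot_quot_qlift subspace_tens_relA linear_fmult_right)
    moreover have "fmult (\<rho> h - p) q \<in> R"
      using that \<rho>[of h] by (intro H.fmult_tens_relA_right) (simp add: qcls_eq_iff subspace_tens_relA)
    ultimately show ?thesis by (simp add: qcls_eq_iff subspace_tens_relA fmult_simps)
  qed
  have act_linear: "linear_quot_quot R R (act h)" for h
    unfolding act_def using left[OF \<rho>]
    by (intro linear_quot_quot_qlift subspace_tens_relA linear_fmult_right)
  \<comment> \<open>The choice \<open>\<rho>\<close> need not be linear, but
    \<open>\<rho> x + \<rho> y\<close> is one more representative, and \<open>act\<close> may be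
    computed with any.\<close>
  have add: "\<Delta> (x + y) = qcls R (\<rho> x + \<rho> y)" for x y
    using \<Delta>_linear unfolding linear_to_quot_def by (metis \<rho> qadd_qcls subspace_tens_relA)
  have scale: "\<Delta> (s c x) = qcls R (fscale c (\<rho> x))" for c x
    using \<Delta>_linear unfolding linear_to_quot_def by (metis \<rho> qscale_qcls subspace_tens_relA)
  have act_linear_left: "linear_to_quot s R (\<lambda>h. act h Z)" if "Z \<in> qspace R" for Z
  proof -
    obtain r where r: "Z = qcls R r" using \<open>Z \<in> qspace R\<close> by (rule qspaceE)
    have "act (x + y) Z = qadd R (act x Z) (act y Z)" for x y
      unfolding r act[OF add] unfolding act[OF \<rho>] by (simp add: fmult_simps qadd_qcls subspace_tens_relA)
    moreover have "act (s c x) Z = qscale R c (act x Z)" for c x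
      unfolding r act[OF scale] unfolding act[OF \<rho>] by (simp add: fmult_simps qscale_qcls subspace_tens_relA)
    moreover have "act x Z \<in> qspace R" for x
      unfolding r act[OF \<rho>] by simp
    ultimately show ?thesis by (simp add: linear_to_quot_def)
  qed
  have act_tproj: "act h (tproj s \<alpha> \<beta> X) = tproj s \<alpha> \<beta> (tmult s Y X)"
    if "X \<in> qspace (tens_rel s)" "Y \<in> qspace (tens_rel s)" "tproj s \<alpha> \<beta> Y = \<Delta> h" for h X Y
  proof -
    obtain q where q: "X = qcls (tens_rel s) q" using \<open>X \<in> _\<close> by (rule qspaceE)
    obtain p where p: "Y = qcls (tens_rel s) p" using \<open>Y \<in> _\<close> by (rule qspaceE)
    show ?thesis using that(3) by (simp add: p q tproj_qcls H.tmult_qcls act)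
  qed
  have act_one: "act 1 Z = Z" if "Z \<in> qspace R" for Z
    using that by (elim qspaceE) (simp add: act[OF C3Mb_one])
  have act_mult: "act (g * h) Z = act g (act h Z)" if "Z \<in> qspace R" for g h Z
  proof -
    obtain r where r: "Z = qcls R r" using \<open>Z \<in> qspace R\<close> by (rule qspaceE)
    \<comment> \<open>Representatives are now taken in \<B>, where \<open>C3Mb_mult\<close> applies,
      instead of from \<open>\<rho>\<close>.\<close>
    obtain p where p: "qcls (tens_rel s) p \<in> \<B>" "\<Delta> g = qcls R p" by (rule comult_representative)
    obtain q where q: "qcls (tens_rel s) q \<in> \<B>" "\<Delta> h = qcls R q" by (rule comult_representative)
    have "\<Delta> (g * h) = qcls R (fmult p q)"
      using C3Mb_mult[OF p(1) q(1)] p q by (simp add: tproj_qcls H.tmult_qcls)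
    then show ?thesis by (simp add: r act p(2) q(2) fmult_assoc)
  qed
  show ?thesis
    by unfold_locales
      (intro exI[of _ act] conjI allI ballI impI
        act_linear act_linear_left act_tproj act_one act_mult; assumption)
qed

text \<open>Pulls \<B> back to formal sums, the vector space in which
  \<open>linear_projection_along\<close> is applied.\<close>

lemma subspace_balancing: "free.subspace {p. qcls (tens_rel s) p \<in> \<B>}"
proof (rule free.subspaceI, goal_cases)
  case (2 p q)
  then show ?case
    using bal_add[of "qcls (tens_rel s) p" "qcls (tens_rel s) q"]
    by (simp add: qadd_qcls subspace_tens_rel)
next
  case (3 c p)
  then show ?case
    using bal_scale[of "qcls (tens_rel s) p" c] by (simp add: qscale_qcls subspace_tens_rel)
qed (simp add: bal_zero)

lemma balancing_section:
  obtains \<gamma> where "linear_quot_quot R (tens_rel s) \<gamma>"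
    "\<And>Z. Z \<in> qspace R \<Longrightarrow> tproj s \<alpha> \<beta> (\<gamma> Z) = Z" "\<And>h. \<gamma> (\<Delta> h) \<in> \<B>"
proof -
  obtain g where g: "Vector_Spaces.linear fscale fscale g" "\<And>p. g p - p \<in> R"
      "\<And>r. r \<in> R \<Longrightarrow> g r = 0" "\<And>b. qcls (tens_rel s) b \<in> \<B> \<Longrightarrow> qcls (tens_rel s) (g b) \<in> \<B>"
    using free.linear_projection_along[OF subspace_tens_relA subspace_balancing] by (metis mem_Collect_eq)
  let ?\<gamma> = "qlift (tens_rel s) g"
  \<comment> \<open>Vanishing on \<open>R\<close> lets \<open>g\<close> descend to
    \<open>qspace R\<close>; that \<open>g p - p\<close> lies in \<open>R\<close> will make the
    induced map a section.\<close>
  have gT: "g r \<in> tens_rel s" if "r \<in> R" for r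
    using g(3)[OF that] free.subspace_0[OF subspace_tens_rel] by simp
  note \<gamma> = linear_quot_quot_qlift[OF subspace_tens_relA subspace_tens_rel g(1) gT]
  show thesis
  proof
    show "linear_quot_quot R (tens_rel s) ?\<gamma>" by (rule \<gamma>)
    show "tproj s \<alpha> \<beta> (?\<gamma> Z) = Z" if "Z \<in> qspace R" for Z
    proof -
      obtain p where "Z = qcls R p" using \<open>Z \<in> qspace R\<close> by (rule qspaceE)
      then show ?thesis using g(2) by (simp add: \<gamma>(2) tproj_qcls qcls_eq_iff subspace_tens_relA)
    qed
    show "?\<gamma> (\<Delta> h) \<in> \<B>" for h
      using comult_representative[of h] by (metis \<gamma>(2) g(4))
  qed
qed

end

lemma (in balanced_hopf_algebroid) weak_lu_hopf_algebroid_takeuchi: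
  assumes tak: "range \<Delta> \<subseteq> takeuchi s \<alpha> \<beta>"
  shows "weak_lu_hopf_algebroid sA s \<alpha> \<beta> \<Delta> \<epsilon> \<tau>"
proof -
  interpret left_bialgebroid sA s \<alpha> \<beta> \<Delta> \<epsilon>
    using tak by (rule left_bialgebroid_takeuchi)
  obtain \<gamma> where \<gamma>: "linear_quot_quot R (tens_rel s) \<gamma>"
      "\<And>Z. Z \<in> qspace R \<Longrightarrow> tproj s \<alpha> \<beta> (\<gamma> Z) = Z" "\<And>h. \<gamma> (\<Delta> h) \<in> \<B>"
    by (rule balancing_section) blast
  have "\<Delta> h \<in> qspace R" for h
    using tak by (auto simp: takeuchi_def)
  \<comment> \<open>The antipode identity holds for every representative of
    \<open>\<Delta> h\<close> in \<B>, in particular for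
    \<open>\<gamma> (\<Delta> h)\<close>.\<close>
  then have "qeval s (\<lambda>(x, y). x * \<tau> y) (\<gamma> (\<Delta> h)) = \<alpha> (\<epsilon> h)" for h
    using \<gamma> by (intro antipode_right) auto
  then show ?thesis
    using \<gamma>(1,2) by unfold_locales
      (blast intro: antipode_antihom antipode_target antipode_left)+
qed

text \<open>Lu's antipode is an antiautomorphism, while a balancing antipode is only an
  antihomomorphism; hence the separate clause with \<open>bij \<tau>\<close>.\<close>

theorem theorem3p4:
  fixes sA :: "'k::field \<Rightarrow> 'a::{ring,monoid_mult} \<Rightarrow> 'a"
    and s :: "'k \<Rightarrow> 'h::{ring,monoid_mult} \<Rightarrow> 'h"
    and \<alpha> \<beta> :: "'a \<Rightarrow> 'h"
    and \<Delta> :: "'h \<Rightarrow> ('h \<times> 'h \<Rightarrow>\<^sub>0 'k) set"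
    and \<epsilon> :: "'h \<Rightarrow> 'a"
    and \<B> :: "('h \<times> 'h \<Rightarrow>\<^sub>0 'k) set set"
    and \<tau> :: "'h \<Rightarrow> 'h"
  assumes "balanced_hopf_algebroid sA s \<alpha> \<beta> \<Delta> \<epsilon> \<B> \<tau>"
    and "range \<Delta> \<subseteq> takeuchi s \<alpha> \<beta>"
  shows "weak_lu_hopf_algebroid sA s \<alpha> \<beta> \<Delta> \<epsilon> \<tau> \<and>
    (bij \<tau> \<longrightarrow> lu_hopf_algebroid sA s \<alpha> \<beta> \<Delta> \<epsilon> \<tau>)"
  using balanced_hopf_algebroid.weak_lu_hopf_algebroid_takeuchi[OF assms]
  by (simp add: lu_hopf_algebroid_def lu_hopf_algebroid_axioms_def)

end
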